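(* Let $\nu$ be a non-degenerate compactly supported probability measure on $\mathbb{R}$ with mean $m_0(\nu)=\int x\,\nu(dx)=0$, and let $\mathcal{K}(\nu)$ be the Cauchy-Stieltjes kernel (CSK) family generated by $\nu$. Suppose that $(T_n)_{n\in\mathbb{N}}$ is a family of $\nu$-orthogonal polynomials such that $T_n$ is of degree $n$. Let $(P_n)_{n\in\mathbb{N}}$ be the polynomials $$P_n(x)=\frac{1}{n!}\left.\frac{\partial^n}{\partial m^n}f_\nu(x,m)\right|_{m=0},\qquad f_\nu(x,m)=\frac{\mathbb{V}_\nu(m)}{\mathbb{V}_\nu(m)+m(m-x)},$$ where $\mathbb{V}_\nu$ is the pseudo-variance function of $\mathcal{K}(\nu)$. Then the generating function of $(T_n)_{n\in\mathbb{N}}$ is given by a Cauchy-Stieltjes type kernel, i.e. $$\sum_{n\in\mathbb{N}}T_n(x)z^n=\frac{1}{u(z)[f(z)-x]},$$ where $u$ and $z\mapsto zf(z)$ are analytic functions around $0$ with $\displaystyle\lim_{z\to0}\frac{u(z)}{z}=\lim_{z\to0}zf(z)=1$, if and only if there exists $t\in\mathbb{R}\setminus\{0\}$ such that, for all $n\in\mathbb{N}$, $$T_n(x)=t^nP_n(x).$$ In this case, $f(z)=1/\psi_\nu(tz)$ and $u(z)=G_\nu(1/\psi_\nu(tz))$.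
   Context: Let $\nu$ be a non-degenerate (not a point mass) compactly supported probability measure on $\mathbb{R}$ with mean $0$. Put $B=\max\{0,\sup\operatorname{supp}\nu\}$, $A=\min\{0,\inf\operatorname{supp}\nu\}$ (so $A<0<B$), $\theta_+=1/B$, $\theta_-=1/A$. For $\theta\in(\theta_-,\theta_+)$ let $$M_\nu(\theta)=\int\frac{1}{1-\theta x}\,\nu(dx),\qquad P_\theta(dx)=\frac{1}{M_\nu(\theta)(1-\theta x)}\,\nu(dx),\qquad k_\nu(\theta)=\int x\,P_\theta(dx).$$ The function $k_\nu$ is strictly increasing on $(\theta_-,\theta_+)$ with $k_\nu(0)=0$; its image is the open interval $(m_-,m_+)$, and $\psi_\nu:(m_-,m_+)\to(\theta_-,\theta_+)$ denotes its inverse. The two-sided CSK family is $\mathcal{K}(\nu)=\{P_\theta:\theta\in(\theta_-,\theta_+)\}=\{Q_m:m\in(m_-,m_+)\}$, $Q_m=P_{\psi_\nu(m)}$. The pseudo-variance function is $\mathbb{V}_\nu(m)=m\left(\frac{1}{\psi_\nu(m)}-m\right)$ for $m\neq0$, extended by continuity at $m=0$ (with $\mathbb{V}_\nu(0)=\int x^2\,\nu(dx)$). One has $Q_m(dx)=f_\nu(x,m)\,\nu(dx)$, so $f_\nu(\cdot,m)$ is the density of $Q_m$ with respect to $\nu$. The Cauchy transform of $\nu$ is $G_\nu(z)=\int\frac{1}{z-x}\,\nu(dx)$. A sequence of polynomials $(T_n)_{n\in\mathbb{N}}$ ($\mathbb{N}$ includes $0$) is $\nu$-orthogonal if $\int T_nT_k\,d\nu=0$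 for all $n\neq k$.
   Formalization: As printed, the "if" part fails unless t = V_ν(0): in general u(z)/z → t/V_ν(0) and zf(z) → V_ν(0)/t. Proved: limits 1 iff T_n = t^n P_n with t = V_ν(0); limits c and 1/c for some real c≠0 iff T_n = t^n P_n for some t≠0; the formulas for f and u in all these cases. *)

theory Defs
  imports
    "HOL-Probability.Probability"
    "HOL-Complex_Analysis.Complex_Analysis"
    "HOL-Computational_Algebra.Polynomial"
begin

definition msupp :: "real measure \<Rightarrow> real set" where
  "msupp \<nu> = {x. \<forall>U. open U \<and> x \<in> U \<longrightarrow> measure \<nu> U > 0}"

definition csk_A :: "real measure \<Rightarrow> real" where
  "csk_A \<nu> = min 0 (Inf (msupp \<nu>))"

definition csk_B :: "real measure \<Rightarrow> real" where
  "csk_B \<nu> = max 0 (Sup (msupp \<nu>))"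

definition csk_interval :: "real measure \<Rightarrow> real set" where
  "csk_interval \<nu> = {1 / csk_A \<nu> <..< 1 / csk_B \<nu>}"

definition csk_M :: "real measure \<Rightarrow> real \<Rightarrow> real" where
  "csk_M \<nu> \<theta> = (LINT x|\<nu>. 1 / (1 - \<theta> * x))"

(* For \<theta> in csk_interval \<nu> the density is positive on the support of \<nu>, so that
   ennreal, which truncates negative values to 0, only acts on a null set. *)
definition csk_measure :: "real measure \<Rightarrow> real \<Rightarrow> real measure" where
  "csk_measure \<nu> \<theta> = density \<nu> (\<lambda>x. ennreal (1 / (csk_M \<nu> \<theta> * (1 - \<theta> * x))))"

definition csk_mean :: "real measure \<Rightarrow> real \<Rightarrow> real" where
  "csk_mean \<nu> \<theta> = (LINT x|csk_measure \<nu> \<theta>. x)"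

(* Meaningful only on the image of csk_interval \<nu> under csk_mean \<nu>,
   an open interval containing 0. *)
definition csk_psi :: "real measure \<Rightarrow> real \<Rightarrow> real" where
  "csk_psi \<nu> = the_inv_into (csk_interval \<nu>) (csk_mean \<nu>)"

definition pseudo_variance :: "real measure \<Rightarrow> real \<Rightarrow> real" where
  "pseudo_variance \<nu> m =
     (if m = 0 then (LINT x|\<nu>. x\<^sup>2) else m * (1 / csk_psi \<nu> m - m))"

definition csk_density :: "real measure \<Rightarrow> real \<Rightarrow> real \<Rightarrow> real" where
  "csk_density \<nu> x m =
     pseudo_variance \<nu> m / (pseudo_variance \<nu> m + m * (m - x))"

definition csk_poly :: "real measure \<Rightarrow> nat \<Rightarrow> real \<Rightarrow> real" where
  "csk_poly \<nu> n x = (deriv ^^ n) (csk_density \<nu> x) 0 / fact n"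

definition cauchy_transform :: "real measure \<Rightarrow> complex \<Rightarrow> complex" where
  "cauchy_transform \<nu> z = (LINT x|\<nu>. 1 / (z - complex_of_real x))"

definition orthogonal_polys :: "real measure \<Rightarrow> (nat \<Rightarrow> real poly) \<Rightarrow> bool" where
  "orthogonal_polys \<nu> T \<longleftrightarrow>
     (\<forall>n k. n \<noteq> k \<longrightarrow> (LINT x|\<nu>. poly (T n) x * poly (T k) x) = 0)"

(* The sum over n of T n (x) z^n equals 1 / (u z * (f z - x)), with the normalisation
   u z / z \<rightarrow> c and z * f z \<rightarrow> 1 / c; the usual normalisation is c = 1.
   Since f has a pole at 0, the map z * f z is analytic around 0 only after its singularity
   at 0 is removed (g below), and the generating function identity is asked for z \<noteq> 0. The
   neighbourhood of 0 on which it holds may depend on x, because f z = x must be avoided. *)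
definition cs_generating ::
  "real \<Rightarrow> (nat \<Rightarrow> real poly) \<Rightarrow> (complex \<Rightarrow> complex) \<Rightarrow> (complex \<Rightarrow> complex) \<Rightarrow> bool" where
  "cs_generating c T u f \<longleftrightarrow>
     u analytic_on {0} \<and>
     (\<exists>g. g analytic_on {0} \<and> (\<forall>\<^sub>F z in at 0. z * f z = g z)) \<and>
     ((\<lambda>z. u z / z) \<longlongrightarrow> of_real c) (at 0) \<and>
     ((\<lambda>z. z * f z) \<longlongrightarrow> of_real (1 / c)) (at 0) \<and>
     (\<forall>x::real. \<forall>\<^sub>F z in at 0.
        (\<lambda>n. of_real (poly (T n) x) * z ^ n) sums (1 / (u z * (f z - of_real x))))"

(* H is the analytic continuation of the real function h to a complex neighbourhood of 0. *)
definition analytic_extension_at_0 :: "(real \<Rightarrow> real) \<Rightarrow> (complex \<Rightarrow> complex) \<Rightarrow> bool" where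
  "analytic_extension_at_0 h H \<longleftrightarrow>
     H analytic_on {0} \<and> (\<forall>\<^sub>F m in nhds 0. H (of_real m) = of_real (h m))"

end

theory Submission
  imports Defs
begin

text \<open>Put \<open>h = 1 / f\<close> and \<open>w = 1 / (u f)\<close>. Both are analytic at \<open>0\<close>, with \<open>h = c z + \<dots>\<close> and
  \<open>w 0 = 1\<close>, and \<open>1 / (u (f - x)) = w / (1 - h x)\<close>, so that \<open>T n x\<close> is the sum of \<open>x ^ k\<close> times the
  \<open>n\<close>-th Taylor coefficient of \<open>w h ^ k\<close>. With \<open>M \<theta> = \<integral> 1 / (1 - \<theta> x) d\<nu>\<close> and
  \<open>N \<theta> = \<integral> x / (1 - \<theta> x) d\<nu>\<close>, integrating the generating function against \<open>T 0 = 1\<close> gives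
  \<open>w M(h) = 1\<close>, and against \<open>T 1\<close>, an affine function of slope \<open>c\<close>, gives \<open>w N(h) = t z\<close> with
  \<open>t = c \<integral> x\<^sup>2 d\<nu>\<close>. The quotient of the two identities is \<open>k(h z) = t z\<close> for the mean function
  \<open>k = N / M\<close>, that is \<open>h z = \<psi>(t z)\<close>. As the density of the family is
  \<open>1 / (M(\<psi> m) (1 - \<psi> m x))\<close>, the generating function is this density at \<open>m = t z\<close>.
  All steps can be reversed.\<close>

subsection \<open>Analytic germs at the origin\<close>

text \<open>As \<open>H\<close> has no constant term, \<open>H ^ k\<close> starts at order
  \<open>k\<close>, so each inner sum may be extended to all \<open>k\<close> up to \<open>n\<close>
  and the two sums exchanged. With \<open>a\<close> the geometric series in \<open>x\<close> this
  gives the coefficients of \<open>T n\<close>; with \<open>a\<close> a series of moments it gives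
  their integrals.\<close>

lemma fps_mult_compose_nth:
  fixes W H a :: "'a::comm_ring_1 fps"
  assumes "fps_nth H 0 = 0"
  shows "fps_nth (W * (a oo H)) n = (\<Sum>k\<le>n. fps_nth a k * fps_nth (W * H ^ k) n)"
proof -
  have "fps_nth (W * (a oo H)) n =
      (\<Sum>i=0..n. fps_nth W i * (\<Sum>k=0..n-i. fps_nth a k * fps_nth (H ^ k) (n - i)))"
    by (simp add: fps_mult_nth fps_compose_nth)
  also have "\<dots> = (\<Sum>i=0..n. fps_nth W i * (\<Sum>k=0..n. fps_nth a k * fps_nth (H ^ k) (n - i)))"
  proof (rule sum.cong[OF refl])
    fix i assume "i \<in> {0..n}"
    have "(\<Sum>k=0..n-i. fps_nth a k * fps_nth (H ^ k) (n - i)) =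
        (\<Sum>k=0..n. fps_nth a k * fps_nth (H ^ k) (n - i))"
      using startsby_zero_power_prefix[OF assms] by (intro sum.mono_neutral_left) auto
    then show "fps_nth W i * (\<Sum>k=0..n-i. fps_nth a k * fps_nth (H ^ k) (n - i)) =
        fps_nth W i * (\<Sum>k=0..n. fps_nth a k * fps_nth (H ^ k) (n - i))"
      by (rule arg_cong)
  qed
  also have "\<dots> = (\<Sum>k=0..n. \<Sum>i=0..n. fps_nth W i * (fps_nth a k * fps_nth (H ^ k) (n - i)))"
    unfolding sum_distrib_left by (rule sum.swap)
  also have "\<dots> = (\<Sum>k\<le>n. fps_nth a k * fps_nth (W * H ^ k) n)"
    by (simp add: fps_mult_nth sum_distrib_left atLeast0AtMost algebra_simps)
  finally show ?thesis .
qed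

lemma has_fps_expansion_geometric:
  fixes c :: "'a::{real_normed_field, banach}"
  shows "(\<lambda>z. 1 / (1 - z * c)) has_fps_expansion Abs_fps (\<lambda>n. c ^ n)"
proof (rule has_fps_expansionI)
  have "((\<lambda>z. norm (c * z)) \<longlongrightarrow> norm (c * 0)) (nhds 0)"
    by (intro tendsto_intros filterlim_ident)
  then have "\<forall>\<^sub>F z in nhds 0. norm (c * z) < 1"
    by (rule order_tendstoD) simp
  then show "\<forall>\<^sub>F z in nhds 0. (\<lambda>n. fps_nth (Abs_fps (\<lambda>n. c ^ n)) n * z ^ n) sums (1 / (1 - z * c))"
  proof eventually_elim
    case (elim z)
    then show ?case
      using geometric_sums[of "c * z"] by (simp add: power_mult_distrib mult.commute)
  qed
qed

text \<open>The generating function identity is only available for \<open>z \<noteq> 0\<close>.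
  Convergence at a single nonzero point makes the radius of convergence positive, and continuity of
  both sides at 0 supplies the missing value there.\<close>

lemma sums_punctured_imp_has_fps_expansion:
  fixes F :: "complex \<Rightarrow> complex"
  assumes ana: "F analytic_on {0}"
    and sums: "\<forall>\<^sub>F z in at 0. (\<lambda>n. a n * z ^ n) sums F z"
  shows "F has_fps_expansion Abs_fps a"
proof -
  let ?A = "Abs_fps a"
  obtain z0 where z0: "z0 \<noteq> 0" "(\<lambda>n. a n * z0 ^ n) sums F z0"
  proof -
    from sums obtain d where d: "d > 0"
      "\<And>z. z \<noteq> 0 \<Longrightarrow> dist z 0 < d \<Longrightarrow> (\<lambda>n. a n * z ^ n) sums F z"
      unfolding eventually_at by auto
    from d show ?thesis by (intro that[of "of_real (d / 2)"]) (auto simp: norm_divide)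
  qed
  then have "ereal (norm z0) \<le> fps_conv_radius ?A"
    unfolding fps_conv_radius_def
    by (intro conv_radius_geI) (auto simp: sums_iff)
  then have radius: "fps_conv_radius ?A > 0"
    using z0(1) by (metis ereal_less(2) less_le_trans zero_less_norm_iff)
  have ev: "\<forall>\<^sub>F z in at 0. eval_fps ?A z = F z"
    using sums by eventually_elim (auto simp: eval_fps_def sums_iff)
  have "(eval_fps ?A \<longlongrightarrow> eval_fps ?A 0) (at 0)"
    using has_fps_expansion_imp_continuous[OF eval_fps_has_fps_expansion[OF radius], of UNIV]
    by (simp add: continuous_within)
  moreover have "(F \<longlongrightarrow> F 0) (at 0)"
    using analytic_at_imp_isCont[OF ana] by (simp add: isCont_def)
  ultimately have "eval_fps ?A 0 = F 0"
    using tendsto_cong[OF ev] by (metis at_neq_bot tendsto_unique)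
  with ev have "\<forall>\<^sub>F z in nhds 0. eval_fps ?A z = F z"
    by (simp add: eventually_nhds_conv_at)
  with radius show ?thesis
    by (simp add: has_fps_expansion_def)
qed

lemma analytic_extension_at_0_imp_eq:
  assumes "analytic_extension_at_0 h H"
  shows "H 0 = of_real (h 0)"
  using assms eventually_nhds_x_imp_x[of "\<lambda>m. H (of_real m) = of_real (h m)" 0]
  by (simp add: analytic_extension_at_0_def)

text \<open>Along the real axis \<open>H\<close> is real-valued, so its derivative there is real and
  equals that of \<open>h\<close>. Iterating this identifies the real derivatives in
  \<open>csk_poly\<close> with Taylor coefficients of a complex function.\<close>

lemma analytic_extension_at_0_deriv:
  assumes "analytic_extension_at_0 h H"
  shows "analytic_extension_at_0 (deriv h) (deriv H)"
proof -
  from assms have ana: "H analytic_on {0}"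
    and ev: "\<forall>\<^sub>F m in nhds 0. H (of_real m) = of_real (h m)"
    by (auto simp: analytic_extension_at_0_def)
  from ana obtain S where S: "open S" "0 \<in> S" "H holomorphic_on S"
    by (auto simp: analytic_at)
  have lim: "(of_real \<longlongrightarrow> (of_real 0 :: complex)) (nhds (0::real))"
    by (intro tendsto_intros filterlim_ident)
  have "\<forall>\<^sub>F m in nhds (0::real). (of_real m :: complex) \<in> S"
    using topological_tendstoD[OF lim S(1)] S(2) by simp
  \<comment> \<open>To differentiate at \<open>m\<close>, the equality is needed on a whole
    neighbourhood of \<open>m\<close>, not just at \<open>m\<close>.\<close>
  moreover have "\<forall>\<^sub>F m in nhds 0. \<forall>\<^sub>F y in nhds m. H (of_real y) = of_real (h y)"
    using ev by (simp add: eventually_eventually)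
  ultimately have "\<forall>\<^sub>F m in nhds 0. deriv H (of_real m) = of_real (deriv h m)"
  proof eventually_elim
    case (elim m)
    have "(H has_field_derivative deriv H (of_real m)) (at (of_real m))"
      using S elim(1) holomorphic_derivI by blast
    then have "((\<lambda>y. H (of_real y)) has_vector_derivative deriv H (of_real m)) (at m)"
      using has_vector_derivative_real_field by blast
    then have *: "((\<lambda>y. complex_of_real (h y)) has_vector_derivative deriv H (of_real m)) (at m)"
      using elim(2) eventually_nhds_x_imp_x[OF elim(2)]
      by (subst (asm) has_vector_derivative_cong_ev[where g = "\<lambda>y. complex_of_real (h y)"])
        (auto elim: eventually_mono)
    have re: "(h has_field_derivative Re (deriv H (of_real m))) (at m)"
      using bounded_linear.has_vector_derivative[OF bounded_linear_Re *]
      by (simp add: has_real_derivative_iff_has_vector_derivative)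
    then have "((\<lambda>y. complex_of_real (h y)) has_vector_derivative of_real (Re (deriv H (of_real m)))) (at m)"
      by (simp add: has_real_derivative_iff_has_vector_derivative has_vector_derivative_of_real)
    with * have "deriv H (of_real m) = of_real (Re (deriv H (of_real m)))"
      by (rule vector_derivative_unique_at)
    with re show ?case by (simp add: DERIV_imp_deriv)
  qed
  with ana show ?thesis
    by (auto simp: analytic_extension_at_0_def intro: analytic_deriv)
qed

lemma analytic_extension_at_0_Taylor_coeff:
  assumes "analytic_extension_at_0 h H" "H has_fps_expansion F"
  shows "of_real ((deriv ^^ n) h 0 / fact n) = fps_nth F n"
proof -
  have "analytic_extension_at_0 ((deriv ^^ n) h) ((deriv ^^ n) H)"
    by (induction n) (use assms(1) analytic_extension_at_0_deriv in auto)
  then show ?thesis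
    using fps_nth_fps_expansion[OF assms(2), of n]
    by (simp add: analytic_extension_at_0_imp_eq)
qed

lemma eventually_nhds_0_of_real:
  assumes "\<forall>\<^sub>F z in nhds (0::complex). P z"
  shows "\<forall>\<^sub>F m in nhds 0. P (of_real m)"
proof -
  have "filterlim (of_real :: real \<Rightarrow> complex) (nhds (of_real 0)) (nhds 0)"
    by (intro tendsto_of_real filterlim_ident)
  with assms show ?thesis
    by (simp add: eventually_compose_filterlim)
qed

text \<open>The difference quotient of \<open>q\<close> at 0 has a removable singularity, filled by
  the derivative.\<close>

lemma analytic_at_0_factor:
  assumes "q analytic_on {0}" "q 0 = 0"
  obtains p where "p analytic_on {0}" "p 0 = deriv q 0" "\<And>z. q z = z * p z"
proof -
  obtain S where S: "open S" "0 \<in> S" "q holomorphic_on S"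
    using assms(1) by (auto simp: analytic_at)
  let ?p = "\<lambda>z. if z = 0 then deriv q 0 else (q z - q 0) / (z - 0)"
  have "?p holomorphic_on S"
    using S by (intro pole_lemma) (auto simp: interior_open)
  then have "?p analytic_on {0}"
    using S by (auto simp: analytic_at)
  then show ?thesis
    by (rule that) (auto simp: assms(2))
qed

lemma eventually_compose_analytic_at_0:
  assumes "\<forall>\<^sub>F z in nhds 0. P z" "h analytic_on {0}" "h 0 = (0::complex)"
  shows "\<forall>\<^sub>F z in nhds 0. P (h z)"
proof -
  have "filterlim h (nhds 0) (nhds 0)"
    using analytic_at_imp_isCont[OF assms(2)] tendsto_at_iff_tendsto_nhds[of h 0] assms(3)
    by (simp add: isCont_def)
  with assms(1) show ?thesis by (rule eventually_compose_filterlim)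
qed

lemma analytic_at_0_tendsto:
  "h analytic_on {0} \<Longrightarrow> (h \<longlongrightarrow> h 0) (at 0)"
  using analytic_at_imp_isCont by (simp add: isCont_def)

subsection \<open>Measures with compact support\<close>

text \<open>The complement of the support is the union of all open null sets. This union may be
  uncountable, but by Lindelof countably many of the sets already cover it.\<close>

lemma (in real_distribution) AE_msupp: "AE x in M. x \<in> msupp M"
proof -
  let ?F = "{U. open U \<and> measure M U = 0}"
  have eq: "- msupp M = \<Union>?F"
    by (auto simp: msupp_def order.strict_iff_order)
  obtain F' where F': "F' \<subseteq> ?F" "countable F'" "\<Union>F' = \<Union>?F"
    by (rule Lindelof[of ?F]) auto
  have "(\<Union>U\<in>F'. U) \<in> null_sets M"
    using F' by (intro null_sets_UN') (auto simp: null_sets_def emeasure_eq_measure)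
  then show ?thesis
    using F' eq by (intro AE_I'[of "- msupp M"]) auto
qed

locale csk_generator = real_distribution \<nu> for \<nu> :: "real measure" +
  assumes compact_msupp: "compact (msupp \<nu>)"
    and nondegenerate: "\<nu> \<noteq> return borel a"
    and mean_zero: "(LINT x|\<nu>. x) = 0"
begin

lemma not_AE_const: "\<not> (AE x in \<nu>. x = a)"
proof
  assume ae: "AE x in \<nu>. x = a"
  have "\<nu> = return borel a"
  proof (rule measure_eqI)
    fix A assume A: "A \<in> sets \<nu>"
    have "emeasure \<nu> A = emeasure \<nu> (if a \<in> A then UNIV else {})"
      using ae A by (intro emeasure_eq_AE) auto
    also have "\<dots> = emeasure (return borel a) A"
      using A emeasure_space_1 by auto
    finally show "emeasure \<nu> A = emeasure (return borel a) A" .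
  qed simp
  with nondegenerate show False by blast
qed

text \<open>Non-degeneracy enters here: a vanishing integral would put all the mass at
  \<open>a\<close>. The lemma yields both the injectivity of the mean function and the positivity of
  the variance.\<close>

lemma integral_square_factor_pos:
  assumes "integrable \<nu> (\<lambda>x. g x * (x - a)\<^sup>2)" "AE x in \<nu>. g x > 0"
  shows "(LINT x|\<nu>. g x * (x - a)\<^sup>2) > 0"
proof -
  have nn: "AE x in \<nu>. 0 \<le> g x * (x - a)\<^sup>2"
    using assms(2) by eventually_elim simp
  have "(LINT x|\<nu>. g x * (x - a)\<^sup>2) \<noteq> 0"
  proof
    assume "(LINT x|\<nu>. g x * (x - a)\<^sup>2) = 0"
    then have "AE x in \<nu>. g x * (x - a)\<^sup>2 = 0"
      using integral_nonneg_eq_0_iff_AE[OF assms(1) nn] by simp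
    with assms(2) have "AE x in \<nu>. x = a"
      by eventually_elim simp
    then show False using not_AE_const by blast
  qed
  then show ?thesis
    using integral_nonneg_AE[OF nn] by linarith
qed

definition radius :: real where
  "radius = (SOME R. R > 0 \<and> (\<forall>x\<in>msupp \<nu>. \<bar>x\<bar> \<le> R))"

lemma radius: "radius > 0" "x \<in> msupp \<nu> \<Longrightarrow> \<bar>x\<bar> \<le> radius"
proof -
  have "\<exists>R. R > 0 \<and> (\<forall>x\<in>msupp \<nu>. \<bar>x\<bar> \<le> R)"
    using compact_imp_bounded[OF compact_msupp] by (auto simp: bounded_pos)
  from someI_ex[OF this] show "radius > 0" "x \<in> msupp \<nu> \<Longrightarrow> \<bar>x\<bar> \<le> radius"
    unfolding radius_def by auto
qed

lemma AE_radius: "AE x in \<nu>. \<bar>x\<bar> \<le> radius"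
  using AE_msupp by eventually_elim (rule radius)

lemma integrable_power: "integrable \<nu> (\<lambda>x. x ^ n)"
  by (rule integrable_const_bound[of _ "radius ^ n"])
    (use AE_radius in eventually_elim, auto simp: power_abs intro: power_mono)

lemma msupp_bounds: "x \<in> msupp \<nu> \<Longrightarrow> csk_A \<nu> \<le> x" "x \<in> msupp \<nu> \<Longrightarrow> x \<le> csk_B \<nu>"
proof -
  have b: "bdd_below (msupp \<nu>)" "bdd_above (msupp \<nu>)"
    using compact_imp_bounded[OF compact_msupp]
    by (auto intro: bounded_imp_bdd_below bounded_imp_bdd_above)
  show "x \<in> msupp \<nu> \<Longrightarrow> csk_A \<nu> \<le> x" "x \<in> msupp \<nu> \<Longrightarrow> x \<le> csk_B \<nu>"
    using cInf_lower[OF _ b(1)] cSup_upper[OF _ b(2)]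
    by (auto simp: csk_A_def csk_B_def min.coboundedI2 max.coboundedI2)
qed

lemma integrable_id: "integrable \<nu> (\<lambda>x. x)"
  using integrable_power[of 1] by simp

text \<open>Otherwise \<nu> lives on the nonnegative half-line, and mean 0 would concentrate it at
  0.\<close>

lemma csk_A_neg: "csk_A \<nu> < 0"
proof (rule ccontr)
  assume "\<not> csk_A \<nu> < 0"
  have "AE x in \<nu>. 0 \<le> x"
    using AE_msupp
  proof eventually_elim
    case (elim x)
    then show ?case using msupp_bounds(1)[of x] \<open>\<not> csk_A \<nu> < 0\<close> by linarith
  qed
  then have "AE x in \<nu>. x = 0"
    using integral_nonneg_eq_0_iff_AE[OF integrable_id] mean_zero by simp
  then show False using not_AE_const by blast
qed

lemma csk_B_pos: "csk_B \<nu> > 0"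
proof (rule ccontr)
  assume "\<not> csk_B \<nu> > 0"
  have "AE x in \<nu>. 0 \<le> - x"
    using AE_msupp
  proof eventually_elim
    case (elim x)
    then show ?case using msupp_bounds(2)[of x] \<open>\<not> csk_B \<nu> > 0\<close> by linarith
  qed
  then have "AE x in \<nu>. - x = 0"
    using integral_nonneg_eq_0_iff_AE[of \<nu> "\<lambda>x. - x"] integrable_id mean_zero by simp
  then show False using not_AE_const[of 0] by simp
qed

subsection \<open>The real family\<close>

lemma zero_in_csk_interval: "0 \<in> csk_interval \<nu>"
  using csk_A_neg csk_B_pos by (simp add: csk_interval_def)

lemma open_csk_interval: "open (csk_interval \<nu>)"
  by (simp add: csk_interval_def)

text \<open>The product \<open>\<theta> * x\<close> is linear in \<open>x\<close>, so on the
  interval from \<open>csk_A\<close> to \<open>csk_B\<close> it is largest at an endpoint, where it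
  is below 1. The bound \<open>\<delta>\<close> is uniform in \<open>x\<close>, which makes the
  kernels bounded almost everywhere and hence integrable.\<close>

lemma csk_interval_denominator:
  assumes "\<theta> \<in> csk_interval \<nu>"
  obtains \<delta> where "\<delta> > 0" "\<And>x. x \<in> msupp \<nu> \<Longrightarrow> 1 - \<theta> * x \<ge> \<delta>"
proof
  have "1 / csk_A \<nu> < \<theta>" "\<theta> < 1 / csk_B \<nu>"
    using assms by (auto simp: csk_interval_def)
  then show "1 - max (\<theta> * csk_A \<nu>) (\<theta> * csk_B \<nu>) > 0"
    using csk_A_neg csk_B_pos by (simp add: field_simps)
  fix x assume x: "x \<in> msupp \<nu>"
  have "\<theta> * x \<le> max (\<theta> * csk_A \<nu>) (\<theta> * csk_B \<nu>)"
  proof (cases "\<theta> \<ge> 0")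
    case True
    then show ?thesis using mult_left_mono[OF msupp_bounds(2)[OF x]] by (simp add: le_max_iff_disj)
  next
    case False
    then show ?thesis
      using mult_left_mono_neg[OF msupp_bounds(1)[OF x], of \<theta>] by (simp add: le_max_iff_disj)
  qed
  then show "1 - \<theta> * x \<ge> 1 - max (\<theta> * csk_A \<nu>) (\<theta> * csk_B \<nu>)" by simp
qed

lemma AE_csk_denominator_pos:
  assumes "\<theta> \<in> csk_interval \<nu>"
  shows "AE x in \<nu>. 1 - \<theta> * x > 0"
proof -
  obtain \<delta> where \<delta>: "\<delta> > 0" "\<And>x. x \<in> msupp \<nu> \<Longrightarrow> 1 - \<theta> * x \<ge> \<delta>"
    using csk_interval_denominator[OF assms] by blast
  show ?thesis
    using AE_msupp
  proof eventually_elim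
    case (elim x)
    then show ?case using \<delta>(1) \<delta>(2)[of x] by linarith
  qed
qed

lemma integrable_csk_kernel:
  assumes "\<theta> \<in> csk_interval \<nu>"
  shows "integrable \<nu> (\<lambda>x. x ^ j / (1 - \<theta> * x))"
proof -
  obtain \<delta> where \<delta>: "\<delta> > 0" "\<And>x. x \<in> msupp \<nu> \<Longrightarrow> 1 - \<theta> * x \<ge> \<delta>"
    using csk_interval_denominator[OF assms] by blast
  have "AE x in \<nu>. norm (x ^ j / (1 - \<theta> * x)) \<le> radius ^ j / \<delta>"
    using AE_msupp
  proof eventually_elim
    case (elim x)
    have "norm (x ^ j / (1 - \<theta> * x)) = \<bar>x\<bar> ^ j / (1 - \<theta> * x)"
      using \<delta>(1) \<delta>(2)[OF elim] by (simp add: power_abs)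
    also have "\<dots> \<le> radius ^ j / \<delta>"
      using \<delta> elim radius by (intro frac_le power_mono) (auto simp: less_imp_le)
    finally show ?case .
  qed
  then show ?thesis
    by (intro integrable_const_bound[of _ "radius ^ j / \<delta>"]) auto
qed

lemma csk_M_pos:
  assumes "\<theta> \<in> csk_interval \<nu>"
  shows "csk_M \<nu> \<theta> > 0"
proof -
  have int: "integrable \<nu> (\<lambda>x. 1 / (1 - \<theta> * x))"
    using integrable_csk_kernel[OF assms, of 0] by simp
  have pos: "AE x in \<nu>. 0 < 1 / (1 - \<theta> * x)"
    using AE_csk_denominator_pos[OF assms] by eventually_elim simp
  then have nn: "AE x in \<nu>. 0 \<le> 1 / (1 - \<theta> * x)"
    by eventually_elim simp
  have "csk_M \<nu> \<theta> \<noteq> 0"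
  proof
    assume "csk_M \<nu> \<theta> = 0"
    then have "AE x in \<nu>. 1 / (1 - \<theta> * x) = 0"
      using integral_nonneg_eq_0_iff_AE[OF int nn] by (simp add: csk_M_def)
    with pos have "AE x in \<nu>. False" by eventually_elim simp
    then show False by simp
  qed
  then show ?thesis
    using integral_nonneg_AE[OF nn] by (simp add: csk_M_def order.strict_iff_order)
qed

lemma csk_mean_eq:
  assumes "\<theta> \<in> csk_interval \<nu>"
  shows "csk_mean \<nu> \<theta> = (LINT x|\<nu>. x / (1 - \<theta> * x)) / csk_M \<nu> \<theta>"
proof -
  have nn: "AE x in \<nu>. 0 \<le> 1 / (csk_M \<nu> \<theta> * (1 - \<theta> * x))"
    using AE_csk_denominator_pos[OF assms]
    by eventually_elim (use csk_M_pos[OF assms] in simp)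
  have "csk_mean \<nu> \<theta> = (LINT x|\<nu>. (1 / (csk_M \<nu> \<theta> * (1 - \<theta> * x))) *\<^sub>R x)"
    unfolding csk_mean_def csk_measure_def by (rule Bochner_Integration.integral_density) (use nn in auto)
  also have "\<dots> = (LINT x|\<nu>. x / (1 - \<theta> * x) / csk_M \<nu> \<theta>)"
    by (simp add: mult.commute)
  finally show ?thesis by (simp only: integral_divide_zero)
qed

text \<open>This is the integral of \<open>1 / (1 - \<theta> * x) - \<theta> * (x / (1 - \<theta> *
  x)) = 1\<close>. It replaces 1 / M by 1 - \<theta> m when the two forms of the density are
  compared.\<close>

lemma csk_M_mean:
  assumes "\<theta> \<in> csk_interval \<nu>"
  shows "csk_M \<nu> \<theta> * (1 - \<theta> * csk_mean \<nu> \<theta>) = 1"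
proof -
  have int: "integrable \<nu> (\<lambda>x. 1 / (1 - \<theta> * x))" "integrable \<nu> (\<lambda>x. x / (1 - \<theta> * x))"
    using integrable_csk_kernel[OF assms, of 0] integrable_csk_kernel[OF assms, of 1] by simp_all
  have "(LINT x|\<nu>. 1 / (1 - \<theta> * x) - \<theta> * (x / (1 - \<theta> * x))) = (LINT x|\<nu>. 1)"
  proof (rule integral_cong_AE)
    show "AE x in \<nu>. 1 / (1 - \<theta> * x) - \<theta> * (x / (1 - \<theta> * x)) = 1"
      using AE_csk_denominator_pos[OF assms] by eventually_elim (simp add: field_simps)
  qed auto
  then have "csk_M \<nu> \<theta> - \<theta> * (LINT x|\<nu>. x / (1 - \<theta> * x)) = 1"
    using Bochner_Integration.integral_diff[OF int(1) integrable_mult_right[OF int(2), of \<theta>]]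
    by (simp only: csk_M_def integral_mult_right_zero) (simp add: prob_space[unfolded space_eq_univ])
  then show ?thesis
    using csk_M_pos[OF assms] by (simp add: csk_mean_eq[OF assms] right_diff_distrib)
qed

text \<open>If \<open>\<theta>\<close> and \<open>\<eta>\<close> have the same mean \<open>m\<close>, then \<open>x - m\<close> integrates to \<open>0\<close> against
  \<open>1 / (1 - \<theta> x)\<close> and \<open>1 / (1 - \<eta> x)\<close>, hence against the combination of the two that equals
  \<open>(\<eta> - \<theta>) (x - m) / ((1 - \<theta> x) (1 - \<eta> x))\<close>.\<close>
lemma inj_on_csk_mean: "inj_on (csk_mean \<nu>) (csk_interval \<nu>)"
proof (rule inj_onI)
  fix \<theta> \<eta> assume \<theta>: "\<theta> \<in> csk_interval \<nu>" and \<eta>: "\<eta> \<in> csk_interval \<nu>"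
    and eq: "csk_mean \<nu> \<theta> = csk_mean \<nu> \<eta>"
  define m where "m = csk_mean \<nu> \<theta>"
  have centred: "integrable \<nu> (\<lambda>x. (x - m) / (1 - \<beta> * x))"
    "(LINT x|\<nu>. (x - m) / (1 - \<beta> * x)) = 0"
    if \<beta>: "\<beta> \<in> csk_interval \<nu>" and m: "m = csk_mean \<nu> \<beta>" for \<beta>
  proof -
    have int: "integrable \<nu> (\<lambda>x. 1 / (1 - \<beta> * x))" "integrable \<nu> (\<lambda>x. x / (1 - \<beta> * x))"
      using integrable_csk_kernel[OF \<beta>, of 0] integrable_csk_kernel[OF \<beta>, of 1] by simp_all
    have *: "(\<lambda>x. (x - m) / (1 - \<beta> * x)) = (\<lambda>x. x / (1 - \<beta> * x) - m * (1 / (1 - \<beta> * x)))"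
      by (simp add: diff_divide_distrib)
    show "integrable \<nu> (\<lambda>x. (x - m) / (1 - \<beta> * x))"
      unfolding * using int by (intro Bochner_Integration.integrable_diff integrable_mult_right)
    have "(LINT x|\<nu>. (x - m) / (1 - \<beta> * x)) = (LINT x|\<nu>. x / (1 - \<beta> * x)) - m * csk_M \<nu> \<beta>"
      unfolding *
      using Bochner_Integration.integral_diff[OF int(2) integrable_mult_right[OF int(1), of m]]
      by (simp only: csk_M_def integral_mult_right_zero)
    then show "(LINT x|\<nu>. (x - m) / (1 - \<beta> * x)) = 0"
      using csk_M_pos[OF \<beta>] by (simp add: m csk_mean_eq[OF \<beta>])
  qed
  let ?g = "\<lambda>x. 1 / ((1 - \<theta> * x) * (1 - \<eta> * x))"
  let ?d = "\<lambda>x. (1 - \<eta> * m) * ((x - m) / (1 - \<eta> * x)) - (1 - \<theta> * m) * ((x - m) / (1 - \<theta> * x))"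
  note c\<theta> = centred[OF \<theta> m_def] and c\<eta> = centred[OF \<eta> m_def[unfolded eq]]
  have int_d: "integrable \<nu> ?d" and d0: "(LINT x|\<nu>. ?d x) = 0"
    using Bochner_Integration.integrable_diff[OF integrable_mult_right[OF c\<eta>(1)] integrable_mult_right[OF c\<theta>(1)]]
      Bochner_Integration.integral_diff[OF integrable_mult_right[OF c\<eta>(1)] integrable_mult_right[OF c\<theta>(1)]]
    by (simp_all only: integral_mult_right_zero c\<theta>(2) c\<eta>(2) mult_zero_right diff_zero)
  show "\<theta> = \<eta>"
  proof (rule ccontr)
    assume "\<theta> \<noteq> \<eta>"
    have ae: "AE x in \<nu>. ?g x * (x - m)\<^sup>2 = ?d x / (\<eta> - \<theta>)"
      using AE_csk_denominator_pos[OF \<theta>] AE_csk_denominator_pos[OF \<eta>]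
    proof eventually_elim
      case (elim x)
      then have nz: "1 - \<theta> * x \<noteq> 0" "1 - \<eta> * x \<noteq> 0" "\<eta> - \<theta> \<noteq> 0"
        using \<open>\<theta> \<noteq> \<eta>\<close> by auto
      have "?d x = (1 - \<eta> * m) * (x - m) * (1 - \<theta> * x) * ?g x - (1 - \<theta> * m) * (x - m) * (1 - \<eta> * x) * ?g x"
        using nz by simp
      also have "\<dots> = (\<eta> - \<theta>) * (?g x * (x - m)\<^sup>2)"
        by (simp only: power2_eq_square) algebra
      finally show ?case using nz by simp
    qed
    have "AE x in \<nu>. ?g x > 0"
      using AE_csk_denominator_pos[OF \<theta>] AE_csk_denominator_pos[OF \<eta>] by eventually_elim simp
    moreover have "integrable \<nu> (\<lambda>x. ?g x * (x - m)\<^sup>2)"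
      using Bochner_Integration.integrable_cong_AE[OF _ _ ae] int_d by simp
    ultimately have "(LINT x|\<nu>. ?g x * (x - m)\<^sup>2) > 0"
      by (intro integral_square_factor_pos)
    moreover have "(LINT x|\<nu>. ?g x * (x - m)\<^sup>2) = (LINT x|\<nu>. ?d x / (\<eta> - \<theta>))"
      by (intro integral_cong_AE ae) auto
    ultimately show False using d0 by simp
  qed
qed

lemma pseudo_variance_0_pos: "pseudo_variance \<nu> 0 > 0"
  using integral_square_factor_pos[of "\<lambda>_. 1" 0] integrable_power[of 2]
  by (simp add: pseudo_variance_def)

subsection \<open>Complex extension\<close>

text \<open>Index 0 is the complex extension of \<open>csk_M\<close>, index 1 that of the numerator
  of the mean function; these are M and N in the outline.\<close>

definition moment_kernel :: "nat \<Rightarrow> complex \<Rightarrow> complex" where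
  "moment_kernel j z = (LINT x|\<nu>. of_real x ^ j / (1 - z * of_real x))"

definition moment_fps :: "nat \<Rightarrow> complex fps" where
  "moment_fps j = Abs_fps (\<lambda>n. of_real (LINT x|\<nu>. x ^ (n + j)))"

text \<open>For \<open>norm z * radius < 1\<close> the geometric series in \<open>z * x\<close> is
  dominated on the support by a convergent numerical series, so it may be integrated term by
  term.\<close>

lemma moment_kernel_has_fps_expansion: "moment_kernel j has_fps_expansion moment_fps j"
proof (rule has_fps_expansionI)
  have "((\<lambda>z::complex. norm z * radius) \<longlongrightarrow> norm (0::complex) * radius) (nhds 0)"
    by (intro tendsto_intros filterlim_ident)
  then have "\<forall>\<^sub>F z in nhds (0::complex). norm z * radius < 1"
    by (rule order_tendstoD) simp
  then show "\<forall>\<^sub>F z in nhds 0. (\<lambda>n. fps_nth (moment_fps j) n * z ^ n) sums moment_kernel j z"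
  proof eventually_elim
    case (elim z)
    let ?f = "\<lambda>n x. z ^ n * complex_of_real (x ^ (n + j))"
    have int: "integrable \<nu> (?f n)" for n
      using integrable_power[of "n + j"] by (intro integrable_mult_right integrable_of_real)
    have bound: "norm (?f n x) \<le> (norm z * radius) ^ n * radius ^ j" if "\<bar>x\<bar> \<le> radius" for n x
    proof -
      have "norm (?f n x) = norm z ^ n * \<bar>x\<bar> ^ (n + j)"
        by (simp add: norm_mult norm_power)
      also have "\<dots> \<le> norm z ^ n * radius ^ (n + j)"
        using that by (intro mult_left_mono power_mono) auto
      finally show ?thesis by (simp add: power_mult_distrib power_add)
    qed
    have summable: "summable (\<lambda>n. (norm z * radius) ^ n * radius ^ j)"
      using elim radius(1) by (intro summable_mult2 summable_geometric) (auto simp: abs_mult)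
    have sums: "(\<lambda>n. LINT x|\<nu>. ?f n x) sums (LINT x|\<nu>. (\<Sum>n. ?f n x))"
    proof (rule sums_integral[OF int])
      show "AE x in \<nu>. summable (\<lambda>n. norm (?f n x))"
        using AE_radius
      proof eventually_elim
        case (elim x)
        show ?case
          by (rule summable_comparison_test'[OF summable, of 0]) (use bound[OF elim] in simp)
      qed
      show "summable (\<lambda>n. LINT x|\<nu>. norm (?f n x))"
      proof (rule summable_comparison_test'[OF summable, of 0])
        fix n
        have "(LINT x|\<nu>. norm (?f n x)) \<le> (LINT x|\<nu>. (norm z * radius) ^ n * radius ^ j)"
        proof (rule integral_mono_AE)
          show "AE x in \<nu>. norm (?f n x) \<le> (norm z * radius) ^ n * radius ^ j"
            using AE_radius by eventually_elim (rule bound)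
        qed (use int[of n] in \<open>auto simp del: of_real_power\<close>)
        then show "norm (LINT x|\<nu>. norm (?f n x)) \<le> (norm z * radius) ^ n * radius ^ j"
          by (simp add: prob_space[unfolded space_eq_univ])
      qed
    qed
    have "(LINT x|\<nu>. (\<Sum>n. ?f n x)) = moment_kernel j z"
      unfolding moment_kernel_def
    proof (rule integral_cong_AE)
      show "AE x in \<nu>. (\<Sum>n. ?f n x) = of_real x ^ j / (1 - z * of_real x)"
        using AE_radius
      proof eventually_elim
        case (elim x)
        have "norm (z * of_real x) \<le> norm z * radius"
          using elim by (simp add: norm_mult mult_left_mono)
        then have "(\<lambda>n. (z * of_real x) ^ n * of_real x ^ j) sums (1 / (1 - z * of_real x) * of_real x ^ j)"
          using \<open>norm z * radius < 1\<close> by (intro sums_mult2 geometric_sums) simp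
        moreover have "(\<lambda>n. (z * of_real x) ^ n * of_real x ^ j) = (\<lambda>n. ?f n x)"
          by (simp add: power_mult_distrib power_add mult.assoc)
        ultimately show ?case by (simp add: sums_iff)
      qed
    qed (use int[THEN borel_measurable_integrable] in \<open>auto intro!: borel_measurable_suminf simp del: of_real_power\<close>)
    moreover have "(LINT x|\<nu>. ?f n x) = fps_nth (moment_fps j) n * z ^ n" for n
      by (simp add: moment_fps_def del: of_real_power)
    ultimately show ?case using sums by (simp only:)
  qed
qed

lemma moment_kernel_0 [simp]: "moment_kernel 0 0 = 1" "moment_kernel (Suc 0) 0 = 0"
  using mean_zero by (simp_all add: moment_kernel_def prob_space[unfolded space_eq_univ])

text \<open>This symmetry later shows that small points with a real mean are themselves
  real.\<close>

lemma moment_kernel_cnj: "moment_kernel j (cnj z) = cnj (moment_kernel j z)"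
  unfolding moment_kernel_def by (subst Bochner_Integration.integral_cnj[symmetric]) simp

lemma moment_kernel_of_real:
  "moment_kernel j (of_real \<theta>) = of_real (LINT x|\<nu>. x ^ j / (1 - \<theta> * x))"
  unfolding moment_kernel_def by (subst integral_complex_of_real[symmetric]) simp

lemma cauchy_transform_inverse:
  assumes "z \<noteq> 0"
  shows "cauchy_transform \<nu> (1 / z) = z * moment_kernel 0 z"
proof -
  have "1 / (1 / z - of_real x) = z * (1 / (1 - z * of_real x))" for x
    \<comment> \<open>When the denominator vanishes, both sides are 0 by the convention for division
      by 0.\<close>
    using assms by (cases "1 - z * of_real x = 0") (auto simp: field_simps)
  then show ?thesis
    by (simp add: cauchy_transform_def moment_kernel_def flip: integral_mult_right_zero)
qed

definition csk_mean_ext :: "complex \<Rightarrow> complex" where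
  "csk_mean_ext z = moment_kernel 1 z * inverse (moment_kernel 0 z)"

lemma csk_mean_ext_has_fps_expansion:
  "csk_mean_ext has_fps_expansion moment_fps 1 * inverse (moment_fps 0)"
  unfolding csk_mean_ext_def
  by (intro has_fps_expansion_mult has_fps_expansion_inverse moment_kernel_has_fps_expansion)
    (simp add: moment_fps_def prob_space[unfolded space_eq_univ])

lemma csk_mean_ext_0: "csk_mean_ext 0 = 0"
  by (simp add: csk_mean_ext_def)

lemma deriv_csk_mean_ext_0: "deriv csk_mean_ext 0 = of_real (pseudo_variance \<nu> 0)"
proof -
  have "deriv csk_mean_ext 0 = fps_nth (moment_fps 1 * inverse (moment_fps 0)) 1"
    using fps_nth_fps_expansion[OF csk_mean_ext_has_fps_expansion, of 1] by simp
  also have "\<dots> = of_real (pseudo_variance \<nu> 0)"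
    using mean_zero
    by (simp add: fps_mult_nth moment_fps_def pseudo_variance_def power2_eq_square
        prob_space[unfolded space_eq_univ])
  finally show ?thesis .
qed

lemma csk_mean_ext_of_real:
  assumes "\<theta> \<in> csk_interval \<nu>"
  shows "csk_mean_ext (of_real \<theta>) = of_real (csk_mean \<nu> \<theta>)"
  by (simp add: csk_mean_ext_def moment_kernel_of_real csk_mean_eq[OF assms] csk_M_def divide_inverse)

text \<open>One local inverse is chosen once and for all, with all its properties bundled, so that
  every later statement refers to the same germ.\<close>

definition psi_ext :: "complex \<Rightarrow> complex" where
  "psi_ext = (SOME g. analytic_extension_at_0 (csk_psi \<nu>) g \<and>
     (\<forall>\<^sub>F z in nhds 0. g (csk_mean_ext z) = z) \<and> (\<forall>\<^sub>F m in nhds 0. csk_mean_ext (g m) = m) \<and>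
     deriv g 0 = 1 / of_real (pseudo_variance \<nu> 0))"

text \<open>The derivative of the mean function at 0 is the variance, which is nonzero, so a
  holomorphic local inverse exists. That it extends the real inverse \<open>csk_psi\<close> is the
  point still to be checked.\<close>

lemma psi_ext:
  "analytic_extension_at_0 (csk_psi \<nu>) psi_ext"
  "\<forall>\<^sub>F z in nhds 0. psi_ext (csk_mean_ext z) = z"
  "\<forall>\<^sub>F m in nhds 0. csk_mean_ext (psi_ext m) = m"
  "deriv psi_ext 0 = 1 / of_real (pseudo_variance \<nu> 0)"
proof -
  have "csk_mean_ext analytic_on {0}"
    using csk_mean_ext_has_fps_expansion by (rule has_fps_expansion_imp_analytic_0)
  then obtain S where S: "open S" "0 \<in> S" "csk_mean_ext holomorphic_on S"
    by (auto simp: analytic_at)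
  have dnz: "deriv csk_mean_ext 0 \<noteq> 0"
    using pseudo_variance_0_pos by (simp add: deriv_csk_mean_ext_0)
  obtain r1 where r1: "r1 > 0" "ball 0 r1 \<subseteq> S" "inj_on csk_mean_ext (ball 0 r1)"
    using has_complex_derivative_locally_injective[OF S(3,2,1) dnz] .
  obtain r2 where r2: "r2 > 0" "ball 0 r2 \<subseteq> csk_interval \<nu>"
    using openE[OF open_csk_interval zero_in_csk_interval] by blast
  \<comment> \<open>The ball is centred at 0 so that it is closed under conjugation; its radius
    keeps the mean injective and the real points of the ball inside
    \<open>csk_interval\<close>.\<close>
  define U where "U = ball (0::complex) (min r1 r2)"
  have U: "open U" "0 \<in> U" "csk_mean_ext holomorphic_on U" "inj_on csk_mean_ext U"
  proof -
    have "U \<subseteq> S" "U \<subseteq> ball 0 r1" using r1(2) by (auto simp: U_def)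
    then show "csk_mean_ext holomorphic_on U" "inj_on csk_mean_ext U"
      using S(3) r1(3) holomorphic_on_subset inj_on_subset by blast+
  qed (use r1 r2 in \<open>auto simp: U_def\<close>)
  obtain g where g: "g holomorphic_on (csk_mean_ext ` U)"
    "\<And>z. z \<in> U \<Longrightarrow> deriv csk_mean_ext z * deriv g (csk_mean_ext z) = 1"
    "\<And>z. z \<in> U \<Longrightarrow> g (csk_mean_ext z) = z"
    using holomorphic_has_inverse[OF U(3,1,4)] by blast
  have op: "open (csk_mean_ext ` U)"
    using open_mapping_thm3[OF U(3,1,4)] .
  have zero: "0 \<in> csk_mean_ext ` U"
    using U(2) csk_mean_ext_0 by force
  have im: "\<forall>\<^sub>F m in nhds 0. m \<in> csk_mean_ext ` U"
    using op zero by (rule eventually_nhds_in_open)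
  have "\<forall>\<^sub>F m in nhds 0. g (of_real m) = of_real (csk_psi \<nu> m)"
    using eventually_nhds_0_of_real[OF im]
  proof eventually_elim
    case (elim m)
    then obtain z where z: "z \<in> U" "of_real m = csk_mean_ext z" by auto
    \<comment> \<open>For a real value, \<open>z\<close> and \<open>cnj z\<close> have the same
      image, so injectivity on \<open>U\<close> makes \<open>z\<close> real.\<close>
    have "csk_mean_ext (cnj z) = csk_mean_ext z"
      by (metis complex_cnj_complex_of_real complex_cnj_inverse complex_cnj_mult csk_mean_ext_def
          moment_kernel_cnj z(2))
    moreover have "cnj z \<in> U" using z(1) by (simp add: U_def)
    ultimately have "cnj z = z" using U(4) z(1) by (auto dest: inj_onD)
    then have real: "z = of_real (Re z)"
      by (metis Reals_cnj_iff of_real_Re)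
    have "norm z < r2" using z(1) by (simp add: U_def)
    then have "\<bar>Re z\<bar> < r2" using abs_Re_le_cmod[of z] by linarith
    then have I: "Re z \<in> csk_interval \<nu>" using r2(2) by (auto simp: dist_norm)
    then have "csk_mean \<nu> (Re z) = m"
      using csk_mean_ext_of_real[OF I] real z(2) by (metis of_real_eq_iff)
    then have "csk_psi \<nu> m = Re z"
      using the_inv_into_f_f[OF inj_on_csk_mean I] by (simp add: csk_psi_def)
    then show ?case using g(3)[OF z(1)] real z(2) by simp
  qed
  moreover have "g analytic_on {0}"
    using op zero g(1) by (auto simp: analytic_at)
  moreover have "\<forall>\<^sub>F z in nhds 0. g (csk_mean_ext z) = z"
    using eventually_nhds_in_open[OF U(1,2)] by eventually_elim (rule g(3))
  moreover have "\<forall>\<^sub>F m in nhds 0. csk_mean_ext (g m) = m"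
    using im by eventually_elim (auto simp: g(3))
  moreover have "deriv g 0 = 1 / of_real (pseudo_variance \<nu> 0)"
    using g(2)[OF U(2)] dnz by (simp add: csk_mean_ext_0 deriv_csk_mean_ext_0 field_simps)
  ultimately have "\<exists>g. analytic_extension_at_0 (csk_psi \<nu>) g \<and>
     (\<forall>\<^sub>F z in nhds 0. g (csk_mean_ext z) = z) \<and> (\<forall>\<^sub>F m in nhds 0. csk_mean_ext (g m) = m) \<and>
     deriv g 0 = 1 / of_real (pseudo_variance \<nu> 0)"
    by (auto simp: analytic_extension_at_0_def)
  from someI_ex[OF this] show "analytic_extension_at_0 (csk_psi \<nu>) psi_ext"
    "\<forall>\<^sub>F z in nhds 0. psi_ext (csk_mean_ext z) = z"
    "\<forall>\<^sub>F m in nhds 0. csk_mean_ext (psi_ext m) = m"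
    "deriv psi_ext 0 = 1 / of_real (pseudo_variance \<nu> 0)"
    unfolding psi_ext_def by blast+
qed

lemma psi_ext_0 [simp]: "psi_ext 0 = 0"
  using eventually_nhds_x_imp_x[OF psi_ext(2)] by (simp add: csk_mean_ext_0)

lemma analytic_psi_ext: "psi_ext analytic_on {0}"
  using psi_ext(1) by (simp add: analytic_extension_at_0_def)

lemma tendsto_psi_ext: "(psi_ext \<longlongrightarrow> 0) (nhds 0)"
  using analytic_at_imp_isCont[OF analytic_psi_ext] tendsto_at_iff_tendsto_nhds[of psi_ext 0]
  by (simp add: isCont_def)

text \<open>This is the density of P_\<theta> at \<theta> = \<psi>(m). Written through \<theta>
  instead of the pseudo-variance, it contains no division by \<psi>(m) and is visibly analytic at
  0.\<close>

definition csk_density_ext :: "complex \<Rightarrow> complex \<Rightarrow> complex" where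
  "csk_density_ext x m = 1 / (moment_kernel 0 (psi_ext m) * (1 - psi_ext m * x))"

lemma analytic_csk_density_ext: "csk_density_ext x analytic_on {0}"
proof -
  have "(moment_kernel 0 \<circ> psi_ext) analytic_on {0}"
    using analytic_psi_ext
    by (rule analytic_on_compose) (use moment_kernel_has_fps_expansion has_fps_expansion_imp_analytic_0 in auto)
  then show ?thesis
    unfolding csk_density_ext_def o_def
    by (intro analytic_on_divide analytic_on_mult analytic_on_diff analytic_on_const analytic_psi_ext) auto
qed

text \<open>For m \<noteq> 0 and \<theta> = \<psi>(m), cancelling m in the pseudo-variance formula
  leaves (1 - \<theta> m) / (1 - \<theta> x), and \<open>csk_M_mean\<close> turns the numerator into
  1 / M.\<close>

lemma csk_density_extension:
  "analytic_extension_at_0 (csk_density \<nu> x) (csk_density_ext (of_real x))"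
  unfolding analytic_extension_at_0_def
proof (intro conjI analytic_csk_density_ext)
  have lim: "((\<lambda>m. 1 - psi_ext m * of_real x) \<longlongrightarrow> 1 - 0 * of_real x) (nhds 0)"
    by (intro tendsto_intros tendsto_psi_ext)
  have nz: "\<forall>\<^sub>F m in nhds 0. 1 - psi_ext m * of_real x \<noteq> 0"
    by (rule tendsto_imp_eventually_ne[OF lim]) simp
  obtain r where r: "r > 0" "ball 0 r \<subseteq> csk_interval \<nu>"
    using openE[OF open_csk_interval zero_in_csk_interval] by blast
  \<comment> \<open>This keeps \<psi>(m) in the interval on which the real integral formulas
    hold.\<close>
  have small: "\<forall>\<^sub>F m in nhds 0. norm (psi_ext m) < r"
    by (rule order_tendstoD[OF tendsto_norm[OF tendsto_psi_ext]]) (use r in simp)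
  have eq: "\<forall>\<^sub>F m in nhds 0. psi_ext (of_real m) = of_real (csk_psi \<nu> m)"
    using psi_ext(1) by (simp add: analytic_extension_at_0_def)
  show "\<forall>\<^sub>F m in nhds 0. csk_density_ext (of_real x) (of_real m) = of_real (csk_density \<nu> x m)"
    using eq eventually_nhds_0_of_real[OF nz] eventually_nhds_0_of_real[OF small]
      eventually_nhds_0_of_real[OF psi_ext(3)]
  proof eventually_elim
    case (elim m)
    define \<theta> where "\<theta> = csk_psi \<nu> m"
    have \<theta>: "psi_ext (of_real m) = of_real \<theta>" using elim(1) by (simp add: \<theta>_def)
    have I: "\<theta> \<in> csk_interval \<nu>" using elim(3) r(2) by (auto simp: \<theta> dist_norm)
    have m: "csk_mean \<nu> \<theta> = m"
      using elim(4) csk_mean_ext_of_real[OF I] by (simp add: \<theta>)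
    have M: "csk_M \<nu> \<theta> * (1 - \<theta> * m) = 1" using csk_M_mean[OF I] m by simp
    have x: "1 - \<theta> * x \<noteq> 0"
      using elim(2) by (metis \<theta> of_real_1 of_real_diff of_real_eq_0_iff of_real_mult)
    have "csk_density_ext (of_real x) (of_real m) = of_real (1 / (csk_M \<nu> \<theta> * (1 - \<theta> * x)))"
      by (simp add: csk_density_ext_def \<theta> moment_kernel_of_real csk_M_def)
    also have "1 / (csk_M \<nu> \<theta> * (1 - \<theta> * x)) = csk_density \<nu> x m"
    \<comment> \<open>At \<open>m = 0\<close> both forms equal 1; for \<open>csk_density\<close>
      this rests on the variance being nonzero.\<close>
    proof (cases "m = 0")
      case True
      then have "\<theta> = 0" using \<theta> by simp
      with True M show ?thesis
        using pseudo_variance_0_pos by (simp add: csk_density_def)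
    next
      case False
      then have "\<theta> \<noteq> 0" using m mean_zero by (auto simp: csk_mean_eq[OF I])
      have "csk_density \<nu> x m = (m * (1 / \<theta> - m)) / (m * (1 / \<theta> - x))"
        using False by (simp add: csk_density_def pseudo_variance_def \<theta>_def algebra_simps)
      also have "\<dots> = (1 - \<theta> * m) / (1 - \<theta> * x)"
        using False \<open>\<theta> \<noteq> 0\<close> x by (simp add: divide_simps mult.commute)
      also have "1 - \<theta> * m = 1 / csk_M \<nu> \<theta>"
        using M csk_M_pos[OF I] by (simp add: field_simps)
      finally show ?thesis by simp
    qed
    finally show ?case .
  qed
qed

lemma csk_density_ext_has_fps_expansion:
  "csk_density_ext (of_real x) has_fps_expansion Abs_fps (\<lambda>n. of_real (csk_poly \<nu> n x))"
proof -
  have *: "csk_density_ext (of_real x) has_fps_expansion fps_expansion (csk_density_ext (of_real x)) 0"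
    by (rule analytic_at_imp_has_fps_expansion_0[OF analytic_csk_density_ext])
  have "fps_expansion (csk_density_ext (of_real x)) 0 = Abs_fps (\<lambda>n. of_real (csk_poly \<nu> n x))"
    using analytic_extension_at_0_Taylor_coeff[OF csk_density_extension *]
    by (simp add: fps_eq_iff csk_poly_def)
  with * show ?thesis by simp
qed

subsection \<open>Generating functions of orthogonal polynomials\<close>

text \<open>The scale \<open>t\<close> is forced by the linear coefficient of the second integrated
  identity: \<open>T 1\<close> has slope \<open>c\<close>, so its integral against \<open>x\<close>
  is \<open>c\<close> times the variance.\<close>

lemma cs_generating_imp:
  fixes T :: "nat \<Rightarrow> real poly"
  assumes c: "c \<noteq> 0" and gen: "cs_generating c T u f" and orth: "orthogonal_polys \<nu> T"
  defines "t \<equiv> c * pseudo_variance \<nu> 0"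
  shows "poly (T n) x = t ^ n * csk_poly \<nu> n x"
    and "\<forall>\<^sub>F z in at 0. f z = 1 / psi_ext (of_real t * z) \<and>
           u z = cauchy_transform \<nu> (1 / psi_ext (of_real t * z))"
proof -
  note gen = gen[unfolded cs_generating_def]
  have u: "u analytic_on {0}"
    and lim_u: "((\<lambda>z. u z / z) \<longlongrightarrow> of_real c) (at 0)"
    and lim_f: "((\<lambda>z. z * f z) \<longlongrightarrow> of_real (1 / c)) (at 0)"
    using gen by simp_all
  have sums: "\<forall>\<^sub>F z in at 0. (\<lambda>n. of_real (poly (T n) x) * z ^ n) sums (1 / (u z * (f z - of_real x)))" for x
    using gen by simp
  obtain g where g: "g analytic_on {0}" and ev_g: "\<forall>\<^sub>F z in at 0. z * f z = g z"
    using gen by auto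
  have "(g \<longlongrightarrow> of_real (1 / c)) (at 0)"
    using lim_f unfolding tendsto_cong[OF ev_g] .
  then have g0: "g 0 = 1 / of_real c"
    using tendsto_unique[OF _ analytic_at_0_tendsto[OF g]] by fastforce
  \<comment> \<open>The finite limit of \<open>u z / z\<close> forces \<open>u 0 = 0\<close>, so
    \<open>u z = z * v z\<close> with \<open>v\<close> analytic and \<open>v 0 = c\<close>.\<close>
  have "((\<lambda>z. u z / z * z) \<longlongrightarrow> of_real c * 0) (at 0)"
    by (intro tendsto_mult lim_u tendsto_ident_at)
  moreover have "\<forall>\<^sub>F z in at 0. u z / z * z = u z"
    by (simp add: eventually_at_filter)
  ultimately have "(u \<longlongrightarrow> 0) (at 0)"
    using tendsto_cong by force
  then have "u 0 = 0"
    using tendsto_unique[OF _ analytic_at_0_tendsto[OF u]] by fastforce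
  then obtain v where v: "v analytic_on {0}" "\<And>z. u z = z * v z"
    using analytic_at_0_factor[OF u] by metis
  have ev_v: "\<forall>\<^sub>F z in at 0. u z / z = v z"
    by (simp add: eventually_at_filter v(2))
  have "(v \<longlongrightarrow> of_real c) (at 0)"
    using lim_u unfolding tendsto_cong[OF ev_v] .
  then have v0: "v 0 = of_real c"
    using tendsto_unique[OF _ analytic_at_0_tendsto[OF v(1)]] by fastforce

  \<comment> \<open>Near 0 but away from it, these are 1 / f and 1 / (u f). Through \<open>g\<close>
    and \<open>v\<close>, which are nonzero at 0, they are analytic there despite the pole of
    \<open>f\<close>.\<close>
  define h where "h z = z / g z" for z
  define w where "w z = 1 / (v z * g z)" for z
  have h: "h analytic_on {0}" and w: "w analytic_on {0}"
    unfolding h_def w_def using c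
    by (auto intro!: analytic_on_divide analytic_on_mult g v(1) analytic_on_ident analytic_on_const simp: g0 v0)
  have h0: "h 0 = 0" and w0: "w 0 = 1"
    using c by (simp_all add: h_def w_def g0 v0)
  have "\<forall>\<^sub>F z in at 0. g z \<noteq> 0" "\<forall>\<^sub>F z in at 0. v z \<noteq> 0"
    using tendsto_imp_eventually_ne[OF analytic_at_0_tendsto[OF g], of 0]
      tendsto_imp_eventually_ne[OF analytic_at_0_tendsto[OF v(1)], of 0] c
    by (simp_all add: g0 v0)
  with ev_g have uf: "\<forall>\<^sub>F z in at 0. h z \<noteq> 0 \<and> f z = 1 / h z \<and> u z = h z / w z \<and> w z \<noteq> 0"
    using eventually_neq_at_within[of 0]
  proof eventually_elim
    case (elim z)
    then show ?case by (auto simp: h_def w_def v(2) field_simps)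
  qed
  define H where "H = fps_expansion h 0"
  define W where "W = fps_expansion w 0"
  have hH: "h has_fps_expansion H" and wW: "w has_fps_expansion W"
    unfolding H_def W_def by (intro analytic_at_imp_has_fps_expansion_0 h w)+
  have H0: "fps_nth H 0 = 0" and W0: "fps_nth W 0 = 1"
    using has_fps_expansion_imp_0_eq_fps_nth_0[OF hH] has_fps_expansion_imp_0_eq_fps_nth_0[OF wW]
    by (simp_all add: h0 w0)
  have H1: "fps_nth H 1 = of_real c"
  proof -
    have gG: "g has_fps_expansion fps_expansion g 0"
      by (intro analytic_at_imp_has_fps_expansion_0 g)
    then have G0: "fps_nth (fps_expansion g 0) 0 = 1 / of_real c"
      using has_fps_expansion_imp_0_eq_fps_nth_0 g0 by metis
    have "(\<lambda>z. z * inverse (g z)) has_fps_expansion fps_X * inverse (fps_expansion g 0)"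
      by (intro fps_expansion_intros gG) (use c G0 in simp)
    then have "h has_fps_expansion fps_X * inverse (fps_expansion g 0)"
      by (simp add: h_def[abs_def] divide_inverse)
    with hH have "H = fps_X * inverse (fps_expansion g 0)"
      using fps_expansion_unique_complex by blast
    then show ?thesis by (simp add: G0)
  qed

  define F where "F x z = w z / (1 - h z * x)" for x z
  have F_fps: "F x has_fps_expansion W * (Abs_fps (\<lambda>n. x ^ n) oo H)" for x
  proof -
    have "((\<lambda>z. 1 / (1 - z * x)) \<circ> h) has_fps_expansion (Abs_fps (\<lambda>n. x ^ n) oo H)"
      by (intro has_fps_expansion_compose has_fps_expansion_geometric hH H0)
    from has_fps_expansion_mult[OF wW this] show ?thesis
      by (simp add: F_def[abs_def] o_def)
  qed
  have T_fps: "F (of_real x) has_fps_expansion Abs_fps (\<lambda>n. of_real (poly (T n) x))" for x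
  proof (rule sums_punctured_imp_has_fps_expansion)
    show "F (of_real x) analytic_on {0}"
      using F_fps by (rule has_fps_expansion_imp_analytic_0)
    show "\<forall>\<^sub>F z in at 0. (\<lambda>n. of_real (poly (T n) x) * z ^ n) sums F (of_real x) z"
      using sums[of x] uf
    proof eventually_elim
      case (elim z)
      then have "u z * (f z - of_real x) = (1 - h z * of_real x) / w z"
        by (simp only:) (simp add: right_diff_distrib diff_divide_distrib)
      with elim(1) show ?case by (simp add: F_def)
    qed
  qed
  \<comment> \<open>Two expansions of the same function \<open>F\<close> are compared: the given one
    in \<open>z\<close>, and the geometric series in \<open>h z * x\<close>.\<close>
  have T_eq: "of_real (poly (T n) x) = (\<Sum>k\<le>n. of_real (x ^ k) * fps_nth (W * H ^ k) n)" for n x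
  proof -
    have "Abs_fps (\<lambda>n. of_real (poly (T n) x)) = W * (Abs_fps (\<lambda>n. of_real x ^ n) oo H)"
      using fps_expansion_unique_complex[OF T_fps F_fps] .
    then show ?thesis
      using fps_mult_compose_nth[OF H0, of W "Abs_fps (\<lambda>n. of_real x ^ n)" n]
      by (metis (no_types, lifting) fps_nth_Abs_fps of_real_power sum.cong)
  qed
  \<comment> \<open>Integrating \<open>T_eq\<close> against \<open>x ^ j\<close> replaces each power
    \<open>x ^ k\<close> by the moment of order \<open>k + j\<close>.\<close>
  have T_moment: "of_real (LINT x|\<nu>. poly (T n) x * x ^ j) = fps_nth (W * (moment_fps j oo H)) n" for n j
  proof -
    have "complex_of_real (LINT x|\<nu>. poly (T n) x * x ^ j) = (LINT x|\<nu>. of_real (poly (T n) x * x ^ j))"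
      by (rule integral_complex_of_real[symmetric])
    also have "\<dots> = (LINT x|\<nu>. (\<Sum>k\<le>n. of_real (x ^ (k + j)) * fps_nth (W * H ^ k) n))"
      by (simp add: T_eq sum_distrib_left power_add mult_ac)
    also have "\<dots> = (\<Sum>k\<le>n. (LINT x|\<nu>. of_real (x ^ (k + j)) * fps_nth (W * H ^ k) n))"
      by (rule Bochner_Integration.integral_sum) (intro integrable_mult_left integrable_of_real integrable_power)
    also have "\<dots> = (\<Sum>k\<le>n. fps_nth (moment_fps j) k * fps_nth (W * H ^ k) n)"
      by (simp add: moment_fps_def del: of_real_power)
    finally show ?thesis by (simp add: fps_mult_compose_nth[OF H0])
  qed
  have T0: "poly (T 0) x = 1" for x
    using T_eq[of 0 x] W0 by simp
  have mean_T: "(LINT x|\<nu>. poly (T n) x) = 0" if "n \<noteq> 0" for n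
    using orth that unfolding orthogonal_polys_def by (metis (no_types, lifting) Bochner_Integration.integral_cong T0 mult.right_neutral)
  \<comment> \<open>The coefficients are the integrals of the \<open>T n\<close>; orthogonality to
    \<open>T 0 = 1\<close> kills all but the first.\<close>
  have eq0: "W * (moment_fps 0 oo H) = 1"
  proof (rule fps_ext)
    fix n show "fps_nth (W * (moment_fps 0 oo H)) n = fps_nth 1 n"
      using T_moment[of n 0] mean_T[of n] by (cases "n = 0") (simp_all add: T0 prob_space[unfolded space_eq_univ])
  qed
  have T1: "poly (T 1) x = poly (T 1) 0 + c * x" for x
  proof -
    have *: "complex_of_real (poly (T 1) y) = fps_nth W 1 + of_real (c * y)" for y
      using T_eq[of 1 y] H1 H0 W0 by (simp add: fps_mult_nth)
    have "complex_of_real (poly (T 1) x) = of_real (poly (T 1) 0 + c * x)"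
      unfolding of_real_add * by simp
    then show ?thesis by (simp only: of_real_eq_iff)
  qed
  \<comment> \<open>The coefficients are the integrals of \<open>T n\<close> against
    \<open>x\<close>. Index 0 gives the mean, index 1 gives \<open>t\<close>; beyond that,
    orthogonality to \<open>T 1\<close> applies, whose constant part contributes nothing because
    \<open>T n\<close> has integral 0.\<close>
  have eq1: "W * (moment_fps 1 oo H) = fps_const (of_real t) * fps_X"
  proof (rule fps_ext)
    fix n
    show "fps_nth (W * (moment_fps 1 oo H)) n = fps_nth (fps_const (of_real t) * fps_X) n"
    proof (cases "n \<le> 1")
      case True
      then consider "n = 0" | "n = 1" by linarith
      then show ?thesis
      proof cases
        case 1
        then show ?thesis using mean_zero by (simp add: moment_fps_def)
      next
        case 2
        have "fps_nth (W * (moment_fps 1 oo H)) 1 = of_real (LINT x|\<nu>. x\<^sup>2) * of_real c"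
          unfolding fps_mult_compose_nth[OF H0] using mean_zero H0 H1 W0
          by (simp add: moment_fps_def fps_mult_nth power2_eq_square)
        then show ?thesis using 2 by (simp add: t_def pseudo_variance_def)
      qed
    next
      case False
      have int: "integrable \<nu> (\<lambda>x. poly (T n) x * x ^ j)" for j
      proof -
        have "integrable \<nu> (\<lambda>x. \<Sum>i\<le>degree (T n). coeff (T n) i * x ^ (i + j))"
          by (intro Bochner_Integration.integrable_sum integrable_mult_right integrable_power)
        then show ?thesis by (simp add: poly_altdef sum_distrib_right power_add mult.assoc)
      qed
      have "0 = (LINT x|\<nu>. poly (T n) x * poly (T 1) x)"
        using orth False unfolding orthogonal_polys_def by auto
      also have "\<dots> = (LINT x|\<nu>. poly (T 1) 0 * (poly (T n) x * x ^ 0) + c * (poly (T n) x * x ^ 1))"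
        by (subst T1) (simp add: algebra_simps)
      also have "\<dots> = poly (T 1) 0 * (LINT x|\<nu>. poly (T n) x * x ^ 0) + c * (LINT x|\<nu>. poly (T n) x * x ^ 1)"
        using Bochner_Integration.integral_add[OF integrable_mult_right[OF int] integrable_mult_right[OF int]]
        by (simp only: integral_mult_right_zero)
      also have "\<dots> = c * (LINT x|\<nu>. poly (T n) x * x ^ 1)"
        using mean_T[of n] False by simp
      finally have "(LINT x|\<nu>. poly (T n) x * x ^ 1) = 0" using c by simp
      then show ?thesis using T_moment[of n 1] False by simp
    qed
  qed
  \<comment> \<open>The formal identities become identities of functions near 0.\<close>
  have ev: "\<forall>\<^sub>F z in nhds 0. w z * moment_kernel j (h z) = eval_fps (W * (moment_fps j oo H)) z" for j
  proof -
    have "(\<lambda>z. w z * (moment_kernel j \<circ> h) z) has_fps_expansion W * (moment_fps j oo H)"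
      by (intro has_fps_expansion_mult wW has_fps_expansion_compose hH H0 moment_kernel_has_fps_expansion)
    then show ?thesis
      by (auto simp: has_fps_expansion_def eq_commute)
  qed
  \<comment> \<open>Dividing the second identity by the first gives
    \<open>csk_mean_ext (h z) = t * z\<close>, which is solved for \<open>h z\<close> by the local
    inverse.\<close>
  have wh: "\<forall>\<^sub>F z in nhds 0. h z = psi_ext (of_real t * z) \<and> w z = 1 / moment_kernel 0 (h z)"
    using ev[of 0] ev[of 1] eventually_compose_analytic_at_0[OF psi_ext(2) h h0]
  proof eventually_elim
    case (elim z)
    have M: "w z * moment_kernel 0 (h z) = 1" using elim(1) by (simp add: eq0)
    have N: "w z * moment_kernel 1 (h z) = of_real t * z"
      using elim(2) unfolding eq1 by (simp add: eval_fps_mult)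
    from M have w_eq: "w z = 1 / moment_kernel 0 (h z)"
      by (metis mult_eq_0_iff nonzero_eq_divide_eq zero_neq_one)
    then have "csk_mean_ext (h z) = of_real t * z"
      using N by (simp add: csk_mean_ext_def divide_inverse mult.commute)
    with elim(3) w_eq show ?case by simp
  qed
  have "of_real (poly (T n) x) = complex_of_real (t ^ n * csk_poly \<nu> n x)"
  proof -
    have "(csk_density_ext (of_real x) \<circ> (\<lambda>z. of_real t * z)) has_fps_expansion
        (Abs_fps (\<lambda>n. of_real (csk_poly \<nu> n x)) oo (fps_const (of_real t) * fps_X))"
      by (intro has_fps_expansion_compose csk_density_ext_has_fps_expansion fps_expansion_intros) simp
    moreover have "\<forall>\<^sub>F z in nhds 0. (csk_density_ext (of_real x) \<circ> (\<lambda>z. of_real t * z)) z = F (of_real x) z"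
      using wh by eventually_elim (simp add: csk_density_ext_def F_def)
    ultimately have "F (of_real x) has_fps_expansion
        (Abs_fps (\<lambda>n. of_real (csk_poly \<nu> n x)) oo (fps_const (of_real t) * fps_X))"
      using has_fps_expansion_cong by blast
    from fps_expansion_unique_complex[OF T_fps this] show ?thesis
      by (simp add: fps_compose_linear fps_eq_iff)
  qed
  then show "poly (T n) x = t ^ n * csk_poly \<nu> n x"
    by (simp only: of_real_eq_iff)
  \<comment> \<open>For nonzero \<open>z\<close>, u = h / w = h M(h), which is the Cauchy transform
    at 1 / h.\<close>
  have "\<forall>\<^sub>F z in at 0. h z = psi_ext (of_real t * z) \<and> w z = 1 / moment_kernel 0 (h z)"
    using wh by (simp add: eventually_nhds_conv_at)
  with uf show "\<forall>\<^sub>F z in at 0. f z = 1 / psi_ext (of_real t * z) \<and>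
           u z = cauchy_transform \<nu> (1 / psi_ext (of_real t * z))"
    by eventually_elim (auto simp: cauchy_transform_inverse)
qed

text \<open>With h(z) = \<psi>(t z), the witnesses are f = 1 / h and u = h M(h). The normalisation
  is h'(0) = t \<psi>'(0), that is, \<open>t\<close> divided by the variance.\<close>

lemma csk_poly_imp_cs_generating:
  assumes t: "t \<noteq> 0" and T: "\<And>n x. poly (T n) x = t ^ n * csk_poly \<nu> n x"
  shows "\<exists>u f. cs_generating (t / pseudo_variance \<nu> 0) T u f"
proof -
  define c where "c = t / pseudo_variance \<nu> 0"
  have c: "c \<noteq> 0" using t pseudo_variance_0_pos by (simp add: c_def)
  obtain p where p: "p analytic_on {0}" "p 0 = deriv psi_ext 0" "\<And>z. psi_ext z = z * p z"
    using analytic_at_0_factor[OF analytic_psi_ext] by auto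
  define h where "h z = psi_ext (of_real t * z)" for z
  define q where "q z = of_real t * p (of_real t * z)" for z
  have hq: "h z = z * q z" for z by (simp add: h_def q_def p(3))
  have scale: "(\<lambda>z. F (of_real t * z)) analytic_on {0}" if "F analytic_on {0}" for F
  proof -
    have "(F \<circ> (\<lambda>z. of_real t * z)) analytic_on {0}"
      by (rule analytic_on_compose) (use that in \<open>auto intro: analytic_intros\<close>)
    then show ?thesis by (simp add: o_def)
  qed
  have q: "q analytic_on {0}"
    unfolding q_def by (intro analytic_on_mult analytic_on_const scale p(1))
  have q0: "q 0 = of_real c"
    by (simp add: q_def p(2) psi_ext(4) c_def)
  have h: "h analytic_on {0}"
    unfolding h_def by (rule scale[OF analytic_psi_ext])
  have h0: "h 0 = 0" by (simp add: hq)
  have Mh: "(\<lambda>z. moment_kernel 0 (h z)) analytic_on {0}"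
  proof -
    have "(moment_kernel 0 \<circ> h) analytic_on {0}"
      by (rule analytic_on_compose[OF h])
        (use moment_kernel_has_fps_expansion has_fps_expansion_imp_analytic_0 h0 in auto)
    then show ?thesis by (simp add: o_def)
  qed
  have nz: "\<forall>\<^sub>F z in at 0. h z \<noteq> 0"
  proof -
    have "\<forall>\<^sub>F z in at 0. q z \<noteq> 0"
      using tendsto_imp_eventually_ne[OF analytic_at_0_tendsto[OF q], of 0] c by (simp add: q0)
    then show ?thesis
      using eventually_neq_at_within[of 0] by eventually_elim (simp add: hq)
  qed
  have "cs_generating c T (\<lambda>z. h z * moment_kernel 0 (h z)) (\<lambda>z. 1 / h z)"
    unfolding cs_generating_def
  \<comment> \<open>Since \<open>h z = z * q z\<close> with \<open>q 0 = c\<close>, the function 1 /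
    q removes the singularity of z f(z).\<close>
  proof (intro conjI allI exI[of _ "\<lambda>z. 1 / q z"])
    show "(\<lambda>z. h z * moment_kernel 0 (h z)) analytic_on {0}"
      by (intro analytic_on_mult h Mh)
    show an: "(\<lambda>z. 1 / q z) analytic_on {0}"
      using c by (intro analytic_on_divide analytic_on_const q) (simp add: q0)
    show ev: "\<forall>\<^sub>F z in at 0. z * (1 / h z) = 1 / q z"
      by (simp add: eventually_at_filter hq)
    show "((\<lambda>z. z * (1 / h z)) \<longlongrightarrow> of_real (1 / c)) (at 0)"
      using analytic_at_0_tendsto[OF an] tendsto_cong[OF ev] by (simp add: q0)
    have "\<forall>\<^sub>F z in at 0. h z * moment_kernel 0 (h z) / z = q z * moment_kernel 0 (h z)"
      by (simp add: eventually_at_filter hq)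
    moreover have "((\<lambda>z. q z * moment_kernel 0 (h z)) \<longlongrightarrow> of_real c) (at 0)"
      using analytic_at_0_tendsto[OF analytic_on_mult[OF q Mh]] by (simp add: q0 h0)
    ultimately show "((\<lambda>z. h z * moment_kernel 0 (h z) / z) \<longlongrightarrow> of_real c) (at 0)"
      using tendsto_cong by force
  next
    fix x :: real
    let ?A = "Abs_fps (\<lambda>n. complex_of_real (csk_poly \<nu> n x)) oo (fps_const (of_real t) * fps_X)"
    have *: "(csk_density_ext (of_real x) \<circ> (\<lambda>z. of_real t * z)) has_fps_expansion ?A"
      by (intro has_fps_expansion_compose csk_density_ext_has_fps_expansion fps_expansion_intros) simp
    have A: "fps_nth ?A n = of_real (poly (T n) x)" for n
      by (simp add: fps_compose_linear T)
    have "\<forall>\<^sub>F z in nhds 0. z \<in> eball 0 (fps_conv_radius ?A)"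
      using * by (intro eventually_nhds_in_open) (auto simp: has_fps_expansion_def zero_ereal_def)
    moreover have "\<forall>\<^sub>F z in nhds 0. eval_fps ?A z = csk_density_ext (of_real x) (of_real t * z)"
      using * by (simp add: has_fps_expansion_def)
    ultimately have "\<forall>\<^sub>F z in nhds 0.
        (\<lambda>n. of_real (poly (T n) x) * z ^ n) sums csk_density_ext (of_real x) (of_real t * z)"
    proof eventually_elim
      case (elim z)
      then have "(\<lambda>n. fps_nth ?A n * z ^ n) sums eval_fps ?A z"
        by (intro sums_eval_fps) auto
      with elim(2) show ?case by (simp only: A)
    qed
    then have "\<forall>\<^sub>F z in at 0.
        (\<lambda>n. of_real (poly (T n) x) * z ^ n) sums csk_density_ext (of_real x) (of_real t * z)"
      by (simp add: eventually_nhds_conv_at)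
    with nz show "\<forall>\<^sub>F z in at 0. (\<lambda>n. of_real (poly (T n) x) * z ^ n) sums
        (1 / (h z * moment_kernel 0 (h z) * (1 / h z - of_real x)))"
    proof eventually_elim
      case (elim z)
      \<comment> \<open>The factor \<open>h z\<close>, nonzero here, is moved into the bracket: h (1
        / h - x) = 1 - h x.\<close>
      have "csk_density_ext (of_real x) (of_real t * z) =
          1 / (h z * moment_kernel 0 (h z) * (1 / h z - of_real x))"
        using elim(1) unfolding csk_density_ext_def h_def[symmetric]
        by (intro arg_cong2[of _ _ _ _ "(/)"] refl) (simp add: field_simps)
      with elim(2) show ?case by simp
    qed
  qed
  then show ?thesis unfolding c_def by blast
qed

text \<open>Two different scales would force \<open>csk_poly \<nu> 1\<close>, and with it
  \<open>T 1\<close>, to vanish. The formulas for \<open>f\<close> and \<open>u\<close> are stated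
  for any admissible \<open>t\<close>, so this \<open>t\<close> has to be identified with the one
  computed from \<open>c\<close>.\<close>

lemma csk_poly_scale_unique:
  assumes "\<And>n x. poly (T n) x = s ^ n * csk_poly \<nu> n x"
    and "\<And>n x. poly (T n) x = t ^ n * csk_poly \<nu> n x" and "T 1 \<noteq> 0"
  shows "s = t"
proof (rule ccontr)
  assume "s \<noteq> t"
  have "poly (T 1) x = 0" for x
    using assms(1)[of 1 x] assms(2)[of 1 x] \<open>s \<noteq> t\<close> by simp
  then have "T 1 = 0" using poly_all_0_iff_0 by blast
  with assms(3) show False by simp
qed

end

text \<open>The scale and the normalisation determine each other through t = c V(0). Hence
  normalisation 1 corresponds to t = V(0) alone, while an arbitrary nonzero \<open>t\<close>
  corresponds to a normalisation with arbitrary nonzero \<open>c\<close>; the first two conjuncts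
  treat these two cases and the third covers both.\<close>

theorem theorem3p4:
  fixes \<nu> :: "real measure" and T :: "nat \<Rightarrow> real poly"
  assumes "real_distribution \<nu>"
    and "compact (msupp \<nu>)"
    and "\<not> (\<exists>a. \<nu> = return borel a)"
    and "(LINT x|\<nu>. x) = 0"
    and "\<And>n. T n \<noteq> 0 \<and> degree (T n) = n"
    and "orthogonal_polys \<nu> T"
  shows "((\<exists>u f. cs_generating 1 T u f) \<longleftrightarrow>
            (\<exists>t. t \<noteq> 0 \<and> t = pseudo_variance \<nu> 0 \<and>
                 (\<forall>n x. poly (T n) x = t ^ n * csk_poly \<nu> n x))) \<and>
         ((\<exists>c u f. c \<noteq> 0 \<and> cs_generating c T u f) \<longleftrightarrow>
            (\<exists>t. t \<noteq> 0 \<and> (\<forall>n x. poly (T n) x = t ^ n * csk_poly \<nu> n x))) \<and>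
         (\<forall>c u f t. c \<noteq> 0 \<longrightarrow> cs_generating c T u f \<longrightarrow>
            t \<noteq> 0 \<longrightarrow> (\<forall>n x. poly (T n) x = t ^ n * csk_poly \<nu> n x) \<longrightarrow>
            (\<exists>\<psi>. analytic_extension_at_0 (csk_psi \<nu>) \<psi> \<and>
                 (\<forall>\<^sub>F z in at 0.
                    f z = 1 / \<psi> (of_real t * z) \<and>
                    u z = cauchy_transform \<nu> (1 / \<psi> (of_real t * z)))))"
proof -
  interpret csk_generator \<nu>
    using assms(1-4) by (auto simp: csk_generator_def csk_generator_axioms_def)
  let ?v = "pseudo_variance \<nu> 0"
  have v: "?v \<noteq> 0" using pseudo_variance_0_pos by simp
  note imp = cs_generating_imp[OF _ _ assms(6)]
  show ?thesis
  proof (intro conjI allI impI iffI)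
    assume "\<exists>u f. cs_generating 1 T u f"
    then show "\<exists>t. t \<noteq> 0 \<and> t = ?v \<and> (\<forall>n x. poly (T n) x = t ^ n * csk_poly \<nu> n x)"
      using imp(1)[of 1] v by auto
  next
    assume "\<exists>t. t \<noteq> 0 \<and> t = ?v \<and> (\<forall>n x. poly (T n) x = t ^ n * csk_poly \<nu> n x)"
    then show "\<exists>u f. cs_generating 1 T u f"
      using csk_poly_imp_cs_generating[of ?v T] v by auto
  next
    assume "\<exists>c u f. c \<noteq> 0 \<and> cs_generating c T u f"
    then obtain c u f where c: "c \<noteq> 0" "cs_generating c T u f" by blast
    show "\<exists>t. t \<noteq> 0 \<and> (\<forall>n x. poly (T n) x = t ^ n * csk_poly \<nu> n x)"
      by (rule exI[of _ "c * ?v"]) (use imp(1)[OF c] c(1) v in auto)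
  next
    assume "\<exists>t. t \<noteq> 0 \<and> (\<forall>n x. poly (T n) x = t ^ n * csk_poly \<nu> n x)"
    then obtain t where t: "t \<noteq> 0" "\<And>n x. poly (T n) x = t ^ n * csk_poly \<nu> n x" by blast
    show "\<exists>c u f. c \<noteq> 0 \<and> cs_generating c T u f"
      by (rule exI[of _ "t / ?v"]) (use csk_poly_imp_cs_generating[OF t] t(1) v in auto)
  next
    fix c u f t
    assume c: "c \<noteq> 0" "cs_generating c T u f"
      and t: "\<forall>n x. poly (T n) x = t ^ n * csk_poly \<nu> n x"
    have "t = c * ?v"
      by (rule csk_poly_scale_unique[of T]) (use t imp(1)[OF c] assms(5)[of 1] in auto)
    then show "\<exists>\<psi>. analytic_extension_at_0 (csk_psi \<nu>) \<psi> \<and>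
                 (\<forall>\<^sub>F z in at 0.
                    f z = 1 / \<psi> (of_real t * z) \<and>
                    u z = cauchy_transform \<nu> (1 / \<psi> (of_real t * z)))"
      using imp(2)[OF c] psi_ext(1) by blast
  qed
qed

end
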